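(* Let $n\geq 3$ be an integer. The number of distinct universal cycles for $P_{n,2}$ is equal to \[ n^{n-2}\,[(n-2)!]^{n}. \]
   Context: For a positive integer $n$ let $[n]=\{1,\ldots,n\}$. For $1\le k\le n$, a $k$-permutation is an ordered sequence of $k$ distinct elements of $[n]$, and $P_{n,k}$ denotes the set of all $k$-permutations of $[n]$, so $|P_{n,k}|=n!/(n-k)!$. A universal cycle for $P_{n,k}$ is a cyclic arrangement (periodic sequence) $(x_1,x_2,\ldots,x_{|P_{n,k}|})$ with each $x_i\in[n]$ such that every $k$-permutation in $P_{n,k}$ appears exactly once as $k$ cyclically consecutive entries. Cyclic arrangements are considered up to rotation, i.e., two universal cycles that differ by a cyclic shift are counted as the same. *)

theory Defs
  imports Main
begin

definition k_permutations :: "nat \<Rightarrow> nat \<Rightarrow> nat list set" where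
  "k_permutations n k = {p. length p = k \<and> distinct p \<and> set p \<subseteq> {1..n}}"

text \<open>The \<open>k\<close> cyclically consecutive entries of \<open>xs\<close> starting at the 0-based position \<open>i\<close>.\<close>

definition cyclic_window :: "'a list \<Rightarrow> nat \<Rightarrow> nat \<Rightarrow> 'a list" where
  "cyclic_window xs k i = map (\<lambda>j. xs ! ((i + j) mod length xs)) [0..<k]"

text \<open>Lists representing universal cycles; a choice of starting point is part of the
  list, so a universal cycle proper is a rotation class of such lists.\<close>

definition universal_cycle_lists :: "nat \<Rightarrow> nat \<Rightarrow> nat list set" where
  "universal_cycle_lists n k =
     {xs. length xs = card (k_permutations n k) \<and> set xs \<subseteq> {1..n} \<and>
          (\<forall>p \<in> k_permutations n k. \<exists>!i. i < length xs \<and> cyclic_window xs k i = p)}"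

definition rotation_rel :: "('a list \<times> 'a list) set" where
  "rotation_rel = {(xs, ys). \<exists>m. ys = rotate m xs}"

definition universal_cycles :: "nat \<Rightarrow> nat \<Rightarrow> nat list set set" where
  "universal_cycles n k = universal_cycle_lists n k // rotation_rel"

end

(* A list representing a universal cycle for P_{n,2} is an Eulerian tour of the complete digraph on
   {1..n}, and every rotation class contains exactly one tour that starts with a given arc. The tours
   are counted as in the BEST theorem: a tour is determined by the order in which it leaves each
   vertex, and a family of such orders comes from a tour starting at r if and only if the last exits
   of the vertices other than r form a tree oriented towards r. There are n^(n-2) such trees by
   Cayley's formula, and for each tree the remaining n-2 exits of every vertex can be ordered freely
   (at r the first exit is prescribed instead of the last one). Cayley's formula in turn follows by
   splitting a rooted forest with r roots and k inner vertices at the set A of vertices attached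
   directly to a root: F(R, S) = sum over A of r^|A| F(A, S - A). *)

theory Submission
  imports Defs "HOL-Combinatorics.Multiset_Permutations"
begin

section \<open>Rooted forests as parent functions\<close>

text \<open>Being inductive, this says that iterating \<open>f\<close> arrives in \<open>R\<close>
  after finitely many steps, which excludes cycles outside \<open>R\<close>. A root stops the
  iteration, whatever value \<open>f\<close> has there.\<close>

inductive reaches :: "('a \<Rightarrow> 'a) \<Rightarrow> 'a set \<Rightarrow> 'a \<Rightarrow> bool" for f R where
  root: "v \<in> R \<Longrightarrow> reaches f R v"
| step: "v \<notin> R \<Longrightarrow> reaches f R (f v) \<Longrightarrow> reaches f R v"

lemma reaches_empty: "\<not> reaches f {} v"
proof
  assume "reaches f {} v"
  then show False by induction auto
qed

text \<open>At a fixed point outside \<open>R\<close> the iteration would stay forever. This later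
  makes a prescribed last exit differ from its own vertex.\<close>

lemma reaches_not_fixed:
  assumes "reaches f R v" "v \<notin> R"
  shows "f v \<noteq> v"
  using assms by induction metis+

lemma reaches_cong:
  assumes "reaches f R v" "v \<in> V" "\<And>u. u \<in> V \<Longrightarrow> u \<notin> R \<Longrightarrow> f u \<in> V \<and> g u = f u"
  shows "reaches g R v"
  using assms(1,2)
proof induction
  case (root v)
  then show ?case by (simp add: reaches.root)
next
  case (step v)
  then have "reaches g R (f v)" "g v = f v" using assms(3) by auto
  then show ?case using step.hyps(1) by (metis reaches.step)
qed

text \<open>Only inner vertices have a parent, and the parent functions are extensional, so every
  forest is counted once.\<close>

definition forests :: "'a set \<Rightarrow> 'a set \<Rightarrow> ('a \<Rightarrow> 'a) set" where
  "forests R S = {f \<in> S \<rightarrow>\<^sub>E (R \<union> S). \<forall>v\<in>S. reaches f R v}"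

lemma finite_forests: "finite R \<Longrightarrow> finite S \<Longrightarrow> finite (forests R S)"
  unfolding forests_def by (rule finite_subset[of _ "S \<rightarrow>\<^sub>E (R \<union> S)"]) (auto intro: finite_PiE)

lemma forests_no_roots: "S \<noteq> {} \<Longrightarrow> forests {} S = {}"
  by (auto simp: forests_def reaches_empty)

text \<open>Let \<open>A\<close> be the set of children of roots. Their parents in \<open>R\<close>
  are arbitrary, and the other inner vertices form a forest with root set \<open>A\<close>; gluing
  the two parts inverts the splitting.\<close>

lemma forests_layer_bij:
  assumes "R \<inter> S = {}" "A \<subseteq> S"
  shows "bij_betw (\<lambda>f. (restrict f A, restrict f (S - A)))
           {f \<in> forests R S. {v \<in> S. f v \<in> R} = A} ((A \<rightarrow>\<^sub>E R) \<times> forests A (S - A))"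
proof (rule bij_betw_byWitness[where f' = "\<lambda>(g, h) x. if x \<in> A then g x else h x"])
  show "\<forall>f\<in>{f \<in> forests R S. {v \<in> S. f v \<in> R} = A}.
      (\<lambda>(g, h) x. if x \<in> A then g x else h x) (restrict f A, restrict f (S - A)) = f"
    using assms(2) by (auto simp: forests_def fun_eq_iff PiE_iff extensional_def)
  show "\<forall>gh\<in>(A \<rightarrow>\<^sub>E R) \<times> forests A (S - A).
      (restrict ((\<lambda>(g, h) x. if x \<in> A then g x else h x) gh) A,
       restrict ((\<lambda>(g, h) x. if x \<in> A then g x else h x) gh) (S - A)) = gh"
    using assms(2) by (auto simp: forests_def fun_eq_iff PiE_iff extensional_def restrict_def)
  show "(\<lambda>f. (restrict f A, restrict f (S - A))) ` {f \<in> forests R S. {v \<in> S. f v \<in> R} = A}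
      \<subseteq> (A \<rightarrow>\<^sub>E R) \<times> forests A (S - A)"
  proof (rule image_subsetI)
    fix f assume "f \<in> {f \<in> forests R S. {v \<in> S. f v \<in> R} = A}"
    then have f: "f \<in> forests R S" and A: "A = {v \<in> S. f v \<in> R}" by auto
    have fA: "restrict f A \<in> A \<rightarrow>\<^sub>E R" using A by auto
    define h where "h = restrict f (S - A)"
    then have h: "h v = f v" if "v \<in> S" "v \<notin> A" for v using that by simp
    have fS: "f v \<in> R \<union> S" if "v \<in> S" for v
      using f that by (auto simp: forests_def)
    \<comment> \<open>A path into \<open>R\<close> enters it from a member of \<open>A\<close>,
      where \<open>h\<close> has already arrived.\<close>
    have "reaches h A v" if "reaches f R v" "v \<in> S" for v
      using that
    proof induction
      case (root v)
      then show ?case using assms(1) by auto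
    next
      case (step v)
      show ?case
      proof (cases "v \<in> A")
        case True
        then show ?thesis by (rule reaches.root)
      next
        case False
        then have "f v \<in> S" using fS A step.prems by auto
        then have "reaches h A (h v)" using step.IH h[OF step.prems False] by simp
        with False show ?thesis by (rule reaches.step)
      qed
    qed
    moreover have "reaches f R v" if "v \<in> S" for v
      using f that by (simp add: forests_def)
    moreover have "h v \<in> A \<union> (S - A)" if "v \<in> S - A" for v
    proof -
      have v: "v \<in> S" "v \<notin> A" using that by simp_all
      then have "f v \<notin> R" unfolding A by simp
      then show ?thesis using h[OF v] fS[OF v(1)] by simp
    qed
    moreover have "h \<in> extensional (S - A)" by (simp add: h_def)
    ultimately have "h \<in> forests A (S - A)"
      by (simp add: forests_def PiE_iff)
    then show "(restrict f A, restrict f (S - A)) \<in> (A \<rightarrow>\<^sub>E R) \<times> forests A (S - A)"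
      using fA by (simp add: h_def)
  qed
  show "(\<lambda>(g, h) x. if x \<in> A then g x else h x) ` ((A \<rightarrow>\<^sub>E R) \<times> forests A (S - A))
      \<subseteq> {f \<in> forests R S. {v \<in> S. f v \<in> R} = A}"
  proof clarify
    fix g h assume g: "g \<in> A \<rightarrow>\<^sub>E R" and h: "h \<in> forests A (S - A)"
    define f where "f = (\<lambda>x. if x \<in> A then g x else h x)"
    then have fA: "f v = g v" if "v \<in> A" for v using that by simp
    have fh: "f v = h v" if "v \<notin> A" for v using that f_def by simp
    have hS: "h v \<in> S" if "v \<in> S" "v \<notin> A" for v
      using h that assms(2) by (auto simp: forests_def PiE_iff)
    have gR: "g v \<in> R" if "v \<in> A" for v using g that by (rule PiE_mem)
    have SR: "v \<notin> R" if "v \<in> S" for v using that assms(1) by blast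
    \<comment> \<open>Once \<open>h\<close> is in \<open>A\<close>, the glued map takes one more
      step into \<open>R\<close>.\<close>
    have "reaches f R v" if "reaches h A v" "v \<in> S" for v
      using that
    proof induction
      case (root v)
      then have "f v \<in> R" by (simp add: fA gR)
      then have "reaches f R (f v)" by (rule reaches.root)
      with SR[OF root.prems] show ?case by (rule reaches.step)
    next
      case (step v)
      then have "reaches f R (f v)" by (simp add: fh hS)
      with SR[OF step.prems] show ?case by (rule reaches.step)
    qed
    moreover have "reaches h A v" if "v \<in> S" for v
      using h that by (cases "v \<in> A") (auto simp: forests_def intro: reaches.root)
    ultimately have "\<forall>v\<in>S. reaches f R v" by blast
    moreover have "f \<in> S \<rightarrow>\<^sub>E (R \<union> S)"
    proof (rule PiE_I)
      fix v assume "v \<in> S"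
      then show "f v \<in> R \<union> S" by (cases "v \<in> A") (simp_all add: fA gR fh hS)
    next
      fix v assume v: "v \<notin> S"
      then have "f v = h v" using assms(2) by (intro fh) blast
      then show "f v = undefined"
        using h v by (simp add: forests_def PiE_iff extensional_def)
    qed
    moreover have "f v \<in> R \<longleftrightarrow> v \<in> A" if "v \<in> S" for v
      using that by (cases "v \<in> A") (auto simp: fA gR fh dest: SR hS)
    then have "{v \<in> S. f v \<in> R} = A" using assms(2) by blast
    ultimately show "(\<lambda>x. if x \<in> A then g x else h x) \<in> forests R S \<and>
        {v \<in> S. (if v \<in> A then g v else h v) \<in> R} = A"
      by (simp add: forests_def f_def)
  qed
qed

section \<open>The number of rooted forests and Cayley's formula\<close>

lemma card_forests_layers:
  assumes "finite R" "finite S" "R \<inter> S = {}"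
  shows "card (forests R S) = (\<Sum>A\<in>Pow S. card R ^ card A * card (forests A (S - A)))"
proof -
  have "card (forests R S) = (\<Sum>f\<in>forests R S. 1)" by simp
  also have "\<dots> = (\<Sum>A\<in>Pow S. \<Sum>f\<in>{f \<in> forests R S. {v \<in> S. f v \<in> R} = A}. 1)"
    by (rule sum.group[symmetric]) (use assms finite_forests in auto)
  also have "\<dots> = (\<Sum>A\<in>Pow S. card R ^ card A * card (forests A (S - A)))"
  proof (rule sum.cong)
    fix A assume "A \<in> Pow S"
    then have "A \<subseteq> S" by auto
    moreover from this have "finite A" using assms finite_subset by blast
    ultimately show "(\<Sum>f\<in>{f \<in> forests R S. {v \<in> S. f v \<in> R} = A}. 1) =
        card R ^ card A * card (forests A (S - A))"
      using bij_betw_same_card[OF forests_layer_bij[OF assms(3)], of A]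
      by (simp add: card_PiE card_cartesian_product)
  qed simp
  finally show ?thesis .
qed

lemma sum_Pow_card:
  fixes g :: "nat \<Rightarrow> nat"
  assumes "finite S"
  shows "(\<Sum>A\<in>Pow S. g (card A)) = (\<Sum>j\<le>card S. (card S choose j) * g j)"
proof -
  have "(\<Sum>A\<in>Pow S. g (card A)) = (\<Sum>j\<le>card S. \<Sum>A\<in>{A \<in> Pow S. card A = j}. g (card A))"
    by (rule sum.group[symmetric]) (use assms in \<open>auto intro: card_mono\<close>)
  also have "\<dots> = (\<Sum>j\<le>card S. (card S choose j) * g j)"
    by (rule sum.cong) (use n_subsets[OF assms] in auto)
  finally show ?thesis .
qed

text \<open>The summand for \<open>j = 0\<close> vanishes, absorption turns
  \<open>j * (Suc k choose j)\<close> into \<open>Suc k * (k choose (j - 1))\<close>, and the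
  binomial theorem does the rest.\<close>

lemma sum_index_binomial:
  fixes r m :: nat
  shows "(\<Sum>j\<le>Suc k. (Suc k choose j) * (j * r ^ j * m ^ (Suc k - j))) = Suc k * r * (r + m) ^ k"
proof -
  have "(\<Sum>j\<le>Suc k. (Suc k choose j) * (j * r ^ j * m ^ (Suc k - j)))
      = (\<Sum>j\<le>k. (Suc k choose Suc j) * (Suc j * r ^ Suc j * m ^ (k - j)))"
    by (subst sum.atMost_Suc_shift) simp
  also have "\<dots> = (\<Sum>j\<le>k. Suc k * r * ((k choose j) * r ^ j * m ^ (k - j)))"
  proof (rule sum.cong)
    fix j
    have "(Suc k choose Suc j) * (Suc j * r ^ Suc j * m ^ (k - j)) =
        (Suc j * (Suc k choose Suc j)) * r ^ Suc j * m ^ (k - j)" by (simp only: ac_simps)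
    also have "\<dots> = (Suc k * (k choose j)) * r ^ Suc j * m ^ (k - j)"
      by (simp only: Suc_times_binomial_eq Suc_times_binomial)
    finally show "(Suc k choose Suc j) * (Suc j * r ^ Suc j * m ^ (k - j)) =
        Suc k * r * ((k choose j) * r ^ j * m ^ (k - j))" by (simp only: ac_simps power_Suc)
  qed simp
  also have "\<dots> = Suc k * r * (r + m) ^ k"
    by (simp add: binomial_ring sum_distrib_left)
  finally show ?thesis .
qed

text \<open>The denominator-free form also covers the case without inner vertices.\<close>

lemma card_forests_mult:
  assumes "finite R" "finite S" "R \<inter> S = {}"
  shows "(card R + card S) * card (forests R S) = card R * (card R + card S) ^ card S"
  using assms
proof (induction "card S" arbitrary: R S rule: less_induct)
  case less
  show ?case
  proof (cases "S = {}")
    case True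
    then show ?thesis by (simp add: forests_def)
  next
    case False
    then obtain k where k: "card S = Suc k" using less.prems(2) by (metis card_0_eq not0_implies_Suc)
    have layer: "Suc k * card (forests A (S - A)) = card A * Suc k ^ (Suc k - card A)"
      if "A \<subseteq> S" for A
    proof (cases "A = {}")
      case True
      then show ?thesis using False by (simp add: forests_no_roots)
    next
      case A: False
      have fA: "finite A" using that less.prems(2) finite_subset by blast
      have c: "card (S - A) = Suc k - card A"
        using card_Diff_subset[OF fA that] k by simp
      have le: "card A \<le> Suc k"
        using card_mono[OF less.prems(2) that] k by simp
      have "card (S - A) < card S" using A that less.prems(2)
        by (intro psubset_card_mono) auto
      then have "(card A + card (S - A)) * card (forests A (S - A)) =
          card A * (card A + card (S - A)) ^ card (S - A)"
        using fA less.prems(2) by (intro less.hyps) auto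
      then show ?thesis by (simp only: c le_add_diff_inverse[OF le])
    qed
    \<comment> \<open>The factor \<open>Suc k\<close> makes \<open>layer\<close> applicable to each
      summand; it cancels at the end.\<close>
    have "Suc k * card (forests R S) =
        (\<Sum>A\<in>Pow S. card R ^ card A * (Suc k * card (forests A (S - A))))"
      by (simp only: card_forests_layers[OF less.prems] sum_distrib_left mult.left_commute)
    also have "\<dots> = (\<Sum>A\<in>Pow S. card A * card R ^ card A * Suc k ^ (Suc k - card A))"
    proof (rule sum.cong)
      fix A assume "A \<in> Pow S"
      then show "card R ^ card A * (Suc k * card (forests A (S - A))) =
          card A * card R ^ card A * Suc k ^ (Suc k - card A)"
        by (simp only: layer[of A] Pow_iff ac_simps)
    qed simp
    also have "\<dots> = (\<Sum>j\<le>Suc k. (Suc k choose j) * (j * card R ^ j * Suc k ^ (Suc k - j)))"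
      using sum_Pow_card[OF less.prems(2), of "\<lambda>j. j * card R ^ j * Suc k ^ (Suc k - j)"] k by simp
    also have "\<dots> = Suc k * card R * (card R + Suc k) ^ k"
      by (rule sum_index_binomial)
    finally have "card (forests R S) = card R * (card R + Suc k) ^ k"
      by (simp only: mult.assoc mult_cancel1) simp
    then show ?thesis using k by (simp only: add_Suc_right power_Suc mult.left_commute)
  qed
qed

text \<open>Cayley's formula for trees directed towards a fixed root: with one root and
  \<open>n\<close> vertices in all, the general count reads
  \<open>n * F = n ^ (n - 1)\<close>.\<close>

lemma card_forests_root:
  assumes "finite V" "r \<in> V" "card V \<ge> 2"
  shows "card (forests {r} (V - {r})) = card V ^ (card V - 2)"
proof -
  obtain m where m: "card V = Suc (Suc m)" using assms(3) by (metis add_2_eq_Suc le_Suc_ex)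
  have "card (V - {r}) = Suc m" using assms m by simp
  then have "Suc (Suc m) * card (forests {r} (V - {r})) = Suc (Suc m) * Suc (Suc m) ^ m"
    using card_forests_mult[of "{r}" "V - {r}"] assms by simp
  then show ?thesis unfolding m by (simp only: mult_cancel1) simp
qed

section \<open>Walks and successor lists\<close>

text \<open>The exits from \<open>v\<close> in order of use; together with the starting point these
  lists encode the whole walk.\<close>

definition succs :: "'a \<Rightarrow> 'a list \<Rightarrow> 'a list" where
  "succs v w = map snd (filter (\<lambda>e. fst e = v) (zip w (tl w)))"

lemma succs_simps [simp]:
  "succs v [] = []" "succs v [a] = []"
  "succs v (a # b # w) = (if a = v then b # succs v (b # w) else succs v (b # w))"
  by (simp_all add: succs_def)

lemma length_succs: "length (succs v w) = count (mset (butlast w)) v"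
  by (induction w rule: induct_list012) auto

text \<open>Every position after the first is entered from exactly one vertex, so the sum counts the
  arcs of the walk into \<open>u\<close>.\<close>

lemma sum_count_succs:
  assumes "finite V" "set w \<subseteq> V"
  shows "(\<Sum>v\<in>V. count (mset (succs v w)) u) = count (mset (tl w)) u"
  using assms(2)
proof (induction w rule: induct_list012)
  case (3 a b w)
  have "(\<Sum>v\<in>V. count (mset (succs v (a # b # w))) u) =
      (\<Sum>v\<in>V. (if a = v then (if b = u then 1 else 0) else 0) + count (mset (succs v (b # w))) u)"
    by (rule sum.cong) auto
  also have "\<dots> = (if b = u then 1 else 0) + count (mset w) u"
    using 3 assms(1) by (simp add: sum.distrib)
  finally show ?case by simp
qed auto

lemma succs_eq_imp_eq:
  assumes "w \<noteq> []" "w' \<noteq> []" "hd w = hd w'" "\<And>v. succs v w = succs v w'"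
  shows "w = w'"
  using assms
proof (induction w arbitrary: w' rule: induct_list012)
  case (2 a)
  then show ?case
  proof (cases w' rule: list.exhaust)
    case (Cons c u)
    show ?thesis
    proof (cases u)
      case (Cons d u')
      then show ?thesis using 2(3) 2(4)[of a] \<open>w' = c # u\<close> by simp
    qed (use 2 Cons in auto)
  qed auto
next
  case (3 a b w)
  obtain c u where w': "w' = c # u" using 3 by (cases w') auto
  then have [simp]: "c = a" using 3 by simp
  obtain u' where u: "u = b # u'" using "3.prems"(4)[of a] w' by (cases u) auto
  have "b # w = b # u'"
  proof (rule "3.IH"(2))
    fix v show "succs v (b # w) = succs v (b # u')"
      using "3.prems"(4)[of v] w' u by (cases "v = a") auto
  qed auto
  then show ?case using w' u by simp
qed auto

text \<open>The last exits of a walk lead to its endpoint, because along them the time of the last visit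
  increases.\<close>

lemma last_exits_reach:
  assumes "w \<noteq> []" "\<And>v. v \<in> set w \<Longrightarrow> v \<noteq> last w \<Longrightarrow> f v = last (succs v w)" "v \<in> set w"
  shows "reaches f {last w} v"
  using assms
proof (induction w arbitrary: v rule: induct_list012)
  case (2 a)
  then show ?case by (auto intro: reaches.root)
next
  case (3 a b w)
  \<comment> \<open>Apart from the endpoint, every vertex of the tail has an exit there, so
    prepending \<open>a\<close> does not change its last exit.\<close>
  have nonempty: "succs u (b # w) \<noteq> []" if "u \<in> set (b # w)" "u \<noteq> last (b # w)" for u
  proof -
    have "u \<in> set (butlast (b # w))"
      using that by (metis append_butlast_last_id in_set_butlast_appendI list.distinct(1)
          rotate1.simps(2) set_ConsD set_rotate1)
    then show ?thesis using length_succs[of u "b # w"] by auto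
  qed
  have later: "reaches f {last (b # w)} u" if "u \<in> set (b # w)" for u
  proof (rule "3.IH"(2))
    fix u assume u: "u \<in> set (b # w)" "u \<noteq> last (b # w)"
    then show "f u = last (succs u (b # w))"
      using "3.prems"(2)[of u] nonempty[OF u] by auto
  qed (use that in auto)
  show ?case
  proof (cases "v \<in> set (b # w)")
    case True
    then show ?thesis using later by simp
  next
    case False
    then have v: "v = a" using "3.prems"(3) by auto
    \<comment> \<open>As \<open>a\<close> does not recur, its only exit is the one to
      \<open>b\<close>.\<close>
    have "succs v (b # w) = []" using False length_succs[of v "b # w"]
      by (metis count_mset_0_iff in_set_butlastD length_0_conv)
    moreover have "v \<noteq> last (b # w)" using False last_in_set[of "b # w"] by auto
    ultimately have "f v = b" using "3.prems"(2)[of v] v by simp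
    then show ?thesis using later[of b] \<open>v \<noteq> last (b # w)\<close> by (auto intro: reaches.step)
  qed
qed auto

text \<open>The greedy walk uses the successors of every vertex in the prescribed order until it is
  stuck.\<close>

lemma greedy_walk:
  assumes "finite V" "a \<in> V" "\<And>v. v \<in> V \<Longrightarrow> set (p v) \<subseteq> V"
  shows "\<exists>w rest. w \<noteq> [] \<and> hd w = a \<and> set w \<subseteq> V \<and>
           (\<forall>v\<in>V. p v = succs v w @ rest v) \<and> rest (last w) = []"
  using assms(2,3)
proof (induction "\<Sum>v\<in>V. length (p v)" arbitrary: a p rule: less_induct)
  case less
  show ?case
  proof (cases "p a")
    case Nil
    then show ?thesis using less.prems by (intro exI[of _ "[a]"] exI[of _ p]) auto
  next
    case (Cons b q)
    let ?p = "p(a := q)"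
    have "(\<Sum>v\<in>V. length (?p v)) < (\<Sum>v\<in>V. length (p v))"
      by (rule sum_strict_mono_ex1) (use assms(1) less.prems Cons in auto)
    moreover have b: "b \<in> V" using less.prems Cons by fastforce
    moreover have "set (?p v) \<subseteq> V" if "v \<in> V" for v
      using less.prems(2)[OF that] Cons by (auto split: if_splits)
    ultimately obtain w rest where w: "w \<noteq> []" "hd w = b" "set w \<subseteq> V"
      "\<And>v. v \<in> V \<Longrightarrow> ?p v = succs v w @ rest v" "rest (last w) = []"
      using less.hyps[of ?p b] by metis
    obtain u where u: "w = b # u" using w by (cases w) auto
    have "p v = succs v (a # w) @ rest v" if "v \<in> V" for v
      using w(4)[OF that] Cons u by (auto split: if_splits)
    then show ?thesis using w less.prems(1)
      by (intro exI[of _ "a # w"] exI[of _ rest]) auto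
  qed
qed

text \<open>Entries into a vertex and exits from it balance, up to a correction at the two ends of
  the walk.\<close>

lemma count_tl_butlast:
  assumes "w \<noteq> []"
  shows "count (mset (tl w)) u + (if u = hd w then 1 else 0) =
         count (mset (butlast w)) u + (if u = last w then 1 else 0)"
proof -
  have "mset (hd w # tl w) = mset (butlast w @ [last w])" using assms by simp
  then have "count (mset (hd w # tl w)) u = count (mset (butlast w @ [last w])) u" by simp
  then show ?thesis by (auto split: if_splits)
qed

lemma sum_count_permutations:
  assumes "finite V" "u \<in> V" "\<And>v. v \<in> V \<Longrightarrow> p v \<in> permutations_of_set (V - {v})"
  shows "(\<Sum>v\<in>V. count (mset (p v)) u) = card V - 1"
proof -
  have "count (mset (p v)) u = (if v = u then 0 else 1)" if "v \<in> V" for v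
    using assms(3)[OF that] assms(2) distinct_count_atmost_1[of "p v"]
    by (auto simp: permutations_of_set_def)
  then have "(\<Sum>v\<in>V. count (mset (p v)) u) = (\<Sum>v\<in>V. if v = u then 0 else 1)" by simp
  also have "\<dots> = card (V - {u})"
    using assms by (subst sum.remove[of _ u]) (auto simp: if_distrib sum.If_cases Int_absorb2)
  finally show ?thesis using assms by simp
qed

text \<open>The greedy walk can only get stuck at its start, and having exhausted a vertex it has also
  used all arcs into it; so exhaustion propagates backwards along the last exits.\<close>

lemma tour_exists:
  assumes V: "finite V" "r \<in> V" "card V \<ge> 2"
    and p: "\<And>v. v \<in> V \<Longrightarrow> p v \<in> permutations_of_set (V - {v})"
    and reach: "\<And>v. v \<in> V \<Longrightarrow> reaches (\<lambda>v. last (p v)) {r} v"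
  shows "\<exists>w. w \<noteq> [] \<and> hd w = r \<and> last w = r \<and> set w \<subseteq> V \<and> (\<forall>v\<in>V. succs v w = p v)"
proof -
  have set_p: "set (p v) = V - {v}" and len_p: "length (p v) = card V - 1" if "v \<in> V" for v
    using p[OF that] that V length_finite_permutations_of_set[of "p v" "V - {v}"]
    by (auto simp: permutations_of_set_def)
  obtain w rest where w: "w \<noteq> []" "hd w = r" "set w \<subseteq> V" "rest (last w) = []"
    and split: "\<And>v. v \<in> V \<Longrightarrow> p v = succs v w @ rest v"
    using greedy_walk[of V r p] V set_p by blast
  have total: "count (mset (tl w)) u + (\<Sum>v\<in>V. count (mset (rest v)) u) = card V - 1"
    if "u \<in> V" for u
    using sum_count_permutations[OF V(1) that p] sum_count_succs[OF V(1) w(3), of u] split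
    by (simp add: sum.distrib)
  have exits: "count (mset (butlast w)) u = card V - 1" if "u \<in> V" "rest u = []" for u
    using len_p[OF that(1)] split[OF that(1)] that(2) length_succs[of u w] by simp
  have "last w \<in> V" using w by auto
  \<comment> \<open>Stuck at a vertex other than \<open>r\<close>, the walk would have entered it
    once more than it left it, hence \<open>card V\<close> times, against
    \<open>total\<close>.\<close>
  then have closed: "last w = r"
    using total[of "last w"] exits[of "last w"] w count_tl_butlast[OF w(1), of "last w"]
    by (auto split: if_splits)
  have "rest v = []" if "v \<in> V" for v
    using reach[OF that] that
  proof induction
    case (root v)
    then show ?case using closed w by simp
  next
    case (step v)
    have "p v \<noteq> []" using len_p[OF step.prems] V by auto
    then have u: "last (p v) \<in> V" using set_p[OF step.prems] last_in_set by blast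
    then have "(\<Sum>x\<in>V. count (mset (rest x)) (last (p v))) = 0"
      using total[OF u] exits[OF u step.IH[OF u]] w closed count_tl_butlast[OF w(1), of "last (p v)"]
      by auto
    then have "last (p v) \<notin> set (rest v)"
      using V step.prems by auto
    \<comment> \<open>A nonempty \<open>rest v\<close> would have \<open>last (p v)\<close> as its
      last entry.\<close>
    then show ?case using split[OF step.prems] by (metis last_appendR last_in_set)
  qed
  then show ?thesis using w closed split by (intro exI[of _ w]) auto
qed

section \<open>Counting tours of the complete digraph\<close>

text \<open>Eulerian circuits of the complete digraph on \<open>V\<close>, written with
  \<open>r\<close> at both ends.\<close>

definition tours :: "'a set \<Rightarrow> 'a \<Rightarrow> 'a list set" where
  "tours V r = {w. w \<noteq> [] \<and> hd w = r \<and> last w = r \<and> set w \<subseteq> V \<and>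
     (\<forall>v\<in>V. succs v w \<in> permutations_of_set (V - {v}))}"

text \<open>The last exits form a tree directed towards \<open>r\<close>; since
  \<open>reaches\<close> stops at the root, the last exit of \<open>r\<close> itself is
  free.\<close>

definition exit_systems :: "'a set \<Rightarrow> 'a \<Rightarrow> ('a \<Rightarrow> 'a list) set" where
  "exit_systems V r = {p \<in> PiE V (\<lambda>v. permutations_of_set (V - {v})).
     \<forall>v\<in>V. reaches (\<lambda>v. last (p v)) {r} v}"

lemma succs_outside: "set w \<subseteq> V \<Longrightarrow> v \<notin> V \<Longrightarrow> succs v w = []"
  by (induction w rule: induct_list012) auto

text \<open>The correspondence behind the BEST theorem: \<open>last_exits_reach\<close> yields the
  tree condition, replaying the walk yields injectivity, and \<open>tour_exists\<close> yields
  surjectivity.\<close>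

lemma tours_exit_systems_bij:
  assumes "finite V" "r \<in> V" "card V \<ge> 2"
  shows "bij_betw (\<lambda>w. \<lambda>v\<in>V. succs v w) (tours V r) (exit_systems V r)"
proof (rule bij_betw_imageI)
  show "inj_on (\<lambda>w. \<lambda>v\<in>V. succs v w) (tours V r)"
  proof (rule inj_onI)
    fix w w' assume a: "w \<in> tours V r" "w' \<in> tours V r"
      and eq: "(\<lambda>v\<in>V. succs v w) = (\<lambda>v\<in>V. succs v w')"
    have same: "succs v w = succs v w'" for v
    proof (cases "v \<in> V")
      case True
      then show ?thesis using fun_cong[OF eq, of v] by simp
    next
      case False
      then show ?thesis using a by (auto simp: tours_def succs_outside)
    qed
    have "w \<noteq> []" "w' \<noteq> []" "hd w = hd w'" using a by (simp_all add: tours_def)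
    then show "w = w'" using same by (rule succs_eq_imp_eq)
  qed
  show "(\<lambda>w. \<lambda>v\<in>V. succs v w) ` tours V r = exit_systems V r"
  proof (rule subset_antisym; rule subsetI)
    fix p assume "p \<in> (\<lambda>w. \<lambda>v\<in>V. succs v w) ` tours V r"
    then obtain w where p: "p = (\<lambda>v\<in>V. succs v w)" and w: "w \<in> tours V r" by (rule imageE)
    \<comment> \<open>\<open>last_exits_reach\<close> speaks of visited vertices only; each vertex
      is visited because it has an exit.\<close>
    have cover: "v \<in> set w" if "v \<in> V" for v
    proof -
      have "card (V - {v}) \<ge> 1" using assms that by simp
      then have "V - {v} \<noteq> {}" by (metis card.empty not_one_le_zero)
      then have "succs v w \<noteq> []" using w that by (fastforce simp: tours_def permutations_of_set_def)
      then show ?thesis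
        using length_succs[of v w] by (metis count_mset_0_iff in_set_butlastD length_0_conv)
    qed
    have "reaches (\<lambda>v. last (p v)) {last w} v" if "v \<in> V" for v
      by (rule last_exits_reach) (use w p cover that in \<open>auto simp: tours_def\<close>)
    then show "p \<in> exit_systems V r" using w p by (auto simp: tours_def exit_systems_def)
  next
    fix p assume p: "p \<in> exit_systems V r"
    have "\<exists>w. w \<noteq> [] \<and> hd w = r \<and> last w = r \<and> set w \<subseteq> V \<and> (\<forall>v\<in>V. succs v w = p v)"
      by (rule tour_exists) (use assms p in \<open>auto simp: exit_systems_def\<close>)
    then obtain w where w: "w \<noteq> []" "hd w = r" "last w = r" "set w \<subseteq> V" "\<forall>v\<in>V. succs v w = p v"
      by blast
    then have "w \<in> tours V r" using p by (auto simp: tours_def exit_systems_def)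
    moreover have "p = (\<lambda>v\<in>V. succs v w)"
      using w p by (auto simp: exit_systems_def PiE_iff extensional_def fun_eq_iff)
    ultimately show "p \<in> (\<lambda>w. \<lambda>v\<in>V. succs v w) ` tours V r" by blast
  qed
qed

section \<open>Exit systems and tours with a given first arc\<close>

lemma card_permutations_hd:
  assumes "finite A" "a \<in> A"
  shows "card {p \<in> permutations_of_set A. hd p = a} = fact (card A - 1)"
proof -
  have "{p \<in> permutations_of_set A. hd p = a} = (#) a ` permutations_of_set (A - {a})"
  proof (intro equalityI subsetI)
    fix p assume p: "p \<in> {p \<in> permutations_of_set A. hd p = a}"
    then obtain q where q: "p = a # q" using assms by (cases p) (auto simp: permutations_of_set_def)
    then have "q \<in> permutations_of_set (A - {a})" using p by (auto simp: permutations_of_set_def)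
    then show "p \<in> (#) a ` permutations_of_set (A - {a})" using q by simp
  next
    fix p assume "p \<in> (#) a ` permutations_of_set (A - {a})"
    then obtain q where "p = a # q" "set q = A - {a}" "distinct q"
      by (auto simp: permutations_of_set_def)
    moreover from this have "set p = A" using assms by auto
    ultimately show "p \<in> {p \<in> permutations_of_set A. hd p = a}"
      by (simp add: permutations_of_set_def)
  qed
  then show ?thesis using assms by (simp add: card_image)
qed

lemma card_permutations_last:
  assumes "finite A" "a \<in> A"
  shows "card {p \<in> permutations_of_set A. last p = a} = fact (card A - 1)"
proof -
  have "{p \<in> permutations_of_set A. last p = a} = rev ` {p \<in> permutations_of_set A. hd p = a}"
  proof (intro equalityI subsetI)
    fix p assume p: "p \<in> {p \<in> permutations_of_set A. last p = a}"
    then have "rev p \<in> {p \<in> permutations_of_set A. hd p = a}"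
      by (auto simp: permutations_of_set_def hd_rev)
    then show "p \<in> rev ` {p \<in> permutations_of_set A. hd p = a}" by (metis image_eqI rev_rev_ident)
  qed (auto simp: permutations_of_set_def last_rev)
  then show ?thesis using card_permutations_hd[OF assms] by (simp add: card_image)
qed

text \<open>Over a fixed tree of last exits the lists are chosen independently, each with one
  prescribed entry: the first at \<open>r\<close>, the last elsewhere.\<close>

lemma card_exit_systems_hd:
  assumes V: "finite V" "r \<in> V" "s \<in> V" "r \<noteq> s"
  shows "card {p \<in> exit_systems V r. hd (p r) = s} =
         card V ^ (card V - 2) * fact (card V - 2) ^ card V"
proof -
  let ?P = "{p \<in> exit_systems V r. hd (p r) = s}"
  let ?F = "forests {r} (V - {r})"
  let ?B = "\<lambda>f v. if v = r then {q \<in> permutations_of_set (V - {r}). hd q = s}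
                  else {q \<in> permutations_of_set (V - {v}). last q = f v}"
  let ?l = "\<lambda>p. \<lambda>v\<in>V - {r}. last (p v)"
  have "card {r, s} \<le> card V" using V by (intro card_mono) auto
  then have c2: "card V \<ge> 2" using V(4) by simp
  have nonempty: "q \<noteq> []" if "q \<in> permutations_of_set (V - {v})" "v \<in> V" for q v
  proof -
    have "V - {v} \<noteq> {}" using V(2-4) by blast
    then show ?thesis using permutations_of_setD(1)[OF that(1)] by force
  qed
  have last_V: "last q \<in> V" if "q \<in> permutations_of_set (V - {v})" "v \<in> V" for q v
    using last_in_set[OF nonempty[OF that]] that by (auto simp: permutations_of_set_def)
  have finP: "finite ?P"
    by (rule finite_subset[of _ "PiE V (\<lambda>v. permutations_of_set (V - {v}))"])
      (use V in \<open>auto simp: exit_systems_def intro: finite_PiE\<close>)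
  have "?l p \<in> ?F" if "p \<in> ?P" for p
  proof -
    have pv: "last (p v) \<in> V" if "v \<in> V" for v
      using \<open>p \<in> ?P\<close> that last_V by (auto simp: exit_systems_def PiE_iff)
    \<comment> \<open>At \<open>r\<close> the map \<open>?l p\<close> has the default value
      \<open>undefined\<close>, which is harmless because \<open>r\<close> is a root.\<close>
    have "reaches (?l p) {r} v" if "v \<in> V" for v
      by (rule reaches_cong[of "\<lambda>v. last (p v)" _ _ V])
        (use \<open>p \<in> ?P\<close> that pv in \<open>auto simp: exit_systems_def\<close>)
    then show ?thesis using pv by (auto simp: forests_def)
  qed
  then have "?l ` ?P \<subseteq> ?F" by blast
  moreover have "finite ?F" using V by (intro finite_forests) auto
  ultimately have "(\<Sum>f\<in>?F. \<Sum>p\<in>{p \<in> ?P. ?l p = f}. 1) = (\<Sum>p\<in>?P. 1::nat)"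
    by (intro sum.group finP)
  then have "card ?P = (\<Sum>f\<in>?F. \<Sum>p\<in>{p \<in> ?P. ?l p = f}. 1)" by simp
  also have "\<dots> = (\<Sum>f\<in>?F. fact (card V - 2) ^ card V)"
  proof (rule sum.cong)
    fix f assume f: "f \<in> ?F"
    \<comment> \<open>The tree condition depends on \<open>f\<close> alone, so it does not couple
      the lists, and the fibre is a product.\<close>
    have "{p \<in> ?P. ?l p = f} = PiE V (?B f)"
    proof (intro equalityI subsetI)
      fix p assume "p \<in> {p \<in> ?P. ?l p = f}"
      then show "p \<in> PiE V (?B f)"
        using V by (auto simp: exit_systems_def PiE_iff)
    next
      fix p assume p: "p \<in> PiE V (?B f)"
      then have perm: "p v \<in> permutations_of_set (V - {v})" if "v \<in> V" for v
        using that by (auto simp: PiE_iff split: if_splits)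
      have lp: "last (p v) = f v" if "v \<in> V" "v \<noteq> r" for v
        using that p by (auto simp: PiE_iff)
      have fV: "f v \<in> V" if "v \<in> V" "v \<noteq> r" for v
        using f that V by (force simp: forests_def PiE_iff)
      have "reaches f {r} v" if "v \<in> V" for v
        using that f by (cases "v = r") (auto simp: forests_def intro: reaches.root)
      then have "reaches (\<lambda>v. last (p v)) {r} v" if "v \<in> V" for v
        by (rule reaches_cong[of f _ _ V]) (use that lp fV in auto)
      moreover have "?l p = f"
        using f lp by (auto simp: forests_def PiE_iff extensional_def fun_eq_iff)
      moreover have "hd (p r) = s" using p V by (auto simp: PiE_iff)
      ultimately show "p \<in> {p \<in> ?P. ?l p = f}"
        using perm p by (auto simp: exit_systems_def PiE_iff)
    qed
    moreover have "card (?B f v) = fact (card V - 2)" if "v \<in> V" for v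
    proof (cases "v = r")
      case True
      then show ?thesis
        using card_permutations_hd[of "V - {r}" s] V by (simp add: numeral_2_eq_2)
    next
      case False
      \<comment> \<open>A tree has no fixed point off the root, so \<open>f v\<close> is a possible
        last exit.\<close>
      then have "f v \<in> V - {v}"
        using f that V reaches_not_fixed[of f "{r}" v] by (auto simp: forests_def PiE_iff)
      then show ?thesis
        using card_permutations_last[of "V - {v}" "f v"] V False that by (simp add: numeral_2_eq_2)
    qed
    ultimately show "(\<Sum>p\<in>{p \<in> ?P. ?l p = f}. 1) = fact (card V - 2) ^ card V"
      using V by (simp add: card_PiE)
  qed simp
  also have "\<dots> = card V ^ (card V - 2) * fact (card V - 2) ^ card V"
    using card_forests_root[OF V(1,2) c2] by simp
  finally show ?thesis .
qed

lemma hd_succs_hd: "tl w \<noteq> [] \<Longrightarrow> hd (succs (hd w) w) = hd (tl w)"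
  by (induction w rule: induct_list012) auto

text \<open>Fixing the first arc of a tour prescribes the first exit of \<open>r\<close>, so the
  bijection with exit systems restricts.\<close>

lemma card_tours:
  assumes V: "finite V" "r \<in> V" "s \<in> V" "r \<noteq> s"
  shows "card {w \<in> tours V r. hd (tl w) = s} =
         card V ^ (card V - 2) * fact (card V - 2) ^ card V"
proof -
  have "card {r, s} \<le> card V" using V by (intro card_mono) auto
  then have c2: "card V \<ge> 2" using V(4) by simp
  let ?g = "\<lambda>w. \<lambda>v\<in>V. succs v w"
  note bij = tours_exit_systems_bij[OF V(1,2) c2]
  have hd2: "hd (?g w r) = hd (tl w)" if "w \<in> tours V r" for w
  proof -
    have "set (succs r w) = V - {r}"
      using that V by (intro permutations_of_setD) (simp add: tours_def)
    then have "s \<in> set (succs r w)" using V by simp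
    then have "tl w \<noteq> []" by (auto simp: succs_def)
    then show ?thesis using hd_succs_hd[of w] that V by (simp add: tours_def)
  qed
  have "bij_betw ?g {w \<in> tours V r. hd (tl w) = s} {p \<in> exit_systems V r. hd (p r) = s}"
  proof (rule bij_betw_subset[OF bij])
    show "?g ` {w \<in> tours V r. hd (tl w) = s} = {p \<in> exit_systems V r. hd (p r) = s}"
      (is "_ ` ?W = ?P")
    proof (rule subset_antisym; rule subsetI)
      fix p assume "p \<in> ?g ` ?W"
      then obtain w where w: "p = ?g w" "w \<in> ?W" by (rule imageE)
      then have "p \<in> exit_systems V r" using bij_betw_apply[OF bij, of w] by simp
      then show "p \<in> ?P" using w hd2[of w] by simp
    next
      fix p assume p: "p \<in> ?P"
      then obtain w where w: "p = ?g w" "w \<in> tours V r"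
        using bij_betw_imp_surj_on[OF bij] by (metis (mono_tags) imageE mem_Collect_eq)
      then have "w \<in> ?W" using p hd2[of w] by simp
      then show "p \<in> ?g ` ?W" using w(1) by (rule rev_image_eqI)
    qed
  qed auto
  from bij_betw_same_card[OF this] show ?thesis
    using card_exit_systems_hd[OF V] by simp
qed

section \<open>Universal cycles as tours\<close>

text \<open>Rotation supplies the closing pair from the last entry to the first.\<close>

definition arcs :: "'a list \<Rightarrow> ('a \<times> 'a) list" where
  "arcs xs = zip xs (rotate1 xs)"

lemma length_arcs [simp]: "length (arcs xs) = length xs"
  by (simp add: arcs_def)

lemma zip_rotate1: "length xs = length ys \<Longrightarrow> zip (rotate1 xs) (rotate1 ys) = rotate1 (zip xs ys)"
  by (cases xs; cases ys) auto

lemma arcs_rotate: "arcs (rotate m xs) = rotate m (arcs xs)"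
proof (induction m)
  case (Suc m)
  have "arcs (rotate1 ys) = rotate1 (arcs ys)" for ys :: "'a list"
    by (simp add: arcs_def zip_rotate1)
  then show ?case using Suc by simp
qed simp

lemma cyclic_window_2:
  assumes "i < length xs"
  shows "cyclic_window xs 2 i = [fst (arcs xs ! i), snd (arcs xs ! i)]"
  using assms by (auto simp: cyclic_window_def arcs_def nth_rotate1 numeral_2_eq_2)

lemma cyclic_window_rotate:
  assumes "xs \<noteq> []"
  shows "cyclic_window (rotate m xs) k i = cyclic_window xs k ((m + i) mod length xs)"
  using assms
  by (auto simp: cyclic_window_def nth_rotate mod_simps add.assoc intro!: arg_cong[of _ _ "(!) xs"])

lemma k_permutations_2:
  "k_permutations n 2 = (\<lambda>e. [fst e, snd e]) ` (SIGMA v:{1..n}. {1..n} - {v})"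
proof (rule subset_antisym; rule subsetI)
  fix p assume p: "p \<in> k_permutations n 2"
  then obtain a b where "p = [a, b]"
    by (auto simp: k_permutations_def length_Suc_conv numeral_2_eq_2)
  then show "p \<in> (\<lambda>e. [fst e, snd e]) ` (SIGMA v:{1..n}. {1..n} - {v})"
    using p by (intro image_eqI[of _ _ "(a, b)"]) (auto simp: k_permutations_def)
qed (auto simp: k_permutations_def)

lemma card_k_permutations_2:
  "card (k_permutations n 2) = card (SIGMA v:{1..n}. {1..n} - {v})"
  unfolding k_permutations_2 by (rule card_image) (auto simp: inj_on_def prod_eq_iff)

text \<open>Pigeonhole: a list with as many windows as there are arcs, and with every arc among
  them, has each arc once and no other pair.\<close>

lemma universal_cycle_lists_2:
  "universal_cycle_lists n 2 =
     {xs. distinct (arcs xs) \<and> set (arcs xs) = (SIGMA v:{1..n}. {1..n} - {v})}"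
  (is "_ = {xs. distinct (arcs xs) \<and> set (arcs xs) = ?S}")
proof (rule subset_antisym; rule subsetI)
  fix xs assume "xs \<in> universal_cycle_lists n 2"
  then have len: "length xs = card ?S"
    and ex: "\<And>p. p \<in> k_permutations n 2 \<Longrightarrow> \<exists>i < length xs. cyclic_window xs 2 i = p"
    unfolding universal_cycle_lists_def card_k_permutations_2[symmetric] by blast+
  have "?S \<subseteq> set (arcs xs)"
  proof (rule subsetI)
    fix e assume "e \<in> ?S"
    then have "[fst e, snd e] \<in> k_permutations n 2" unfolding k_permutations_2 by (rule imageI)
    then obtain i where "i < length xs" "cyclic_window xs 2 i = [fst e, snd e]" using ex by blast
    then have "i < length (arcs xs)" "arcs xs ! i = e"
      by (simp_all add: cyclic_window_2 prod_eq_iff)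
    then show "e \<in> set (arcs xs)" by (metis nth_mem)
  qed
  moreover have "card (set (arcs xs)) \<le> card ?S" using card_length[of "arcs xs"] len by simp
  ultimately have "?S = set (arcs xs)" by (intro card_seteq) auto
  moreover from this have "distinct (arcs xs)" using len by (intro card_distinct) simp
  ultimately show "xs \<in> {xs. distinct (arcs xs) \<and> set (arcs xs) = ?S}" by simp
next
  fix xs assume "xs \<in> {xs. distinct (arcs xs) \<and> set (arcs xs) = ?S}"
  then have d: "distinct (arcs xs)" and S: "set (arcs xs) = ?S" by auto
  have "length xs = card (k_permutations n 2)"
    using distinct_card[OF d] S by (simp add: card_k_permutations_2)
  moreover have "set xs \<subseteq> {1..n}"
  proof -
    have "set xs = fst ` set (arcs xs)"
      unfolding arcs_def set_map[symmetric] by (subst map_fst_zip) auto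
    then show ?thesis unfolding S by auto
  qed
  moreover have "\<exists>!i. i < length xs \<and> cyclic_window xs 2 i = p" if p: "p \<in> k_permutations n 2" for p
  proof -
    obtain e where e: "e \<in> set (arcs xs)" "p = [fst e, snd e]"
      using p unfolding k_permutations_2 S[symmetric] by blast
    have "(i < length xs \<and> cyclic_window xs 2 i = p) = (i < length (arcs xs) \<and> arcs xs ! i = e)" for i
      using e by (auto simp: cyclic_window_2 prod_eq_iff)
    then show ?thesis using distinct_Ex1[OF d e(1)] by simp
  qed
  ultimately show "xs \<in> universal_cycle_lists n 2" by (simp add: universal_cycle_lists_def)
qed

text \<open>A repeated pair would repeat its second component in the fibre of its first.\<close>

lemma distinct_if_distinct_fibres:
  assumes "\<And>v. distinct (map snd (filter (\<lambda>e. fst e = v) es))"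
  shows "distinct es"
  using assms
proof (induction es)
  case (Cons e es)
  have "distinct (map snd (filter (\<lambda>e. fst e = v) es))" for v
    using Cons.prems[of v] by (auto split: if_splits)
  moreover have "e \<notin> set es"
    using Cons.prems[of "fst e"] by (auto simp: image_iff)
  ultimately show ?case using Cons.IH by simp
qed simp

text \<open>Turns the global condition on the arcs into the condition at each vertex that defines
  \<open>tours\<close>; the inclusion in \<open>V \<times> V\<close> keeps out tails outside
  \<open>V\<close>.\<close>

lemma distinct_arcs_iff:
  "distinct es \<and> set es = (SIGMA v:V. V - {v}) \<longleftrightarrow>
   set es \<subseteq> V \<times> V \<and>
   (\<forall>v\<in>V. map snd (filter (\<lambda>e. fst e = v) es) \<in> permutations_of_set (V - {v}))"
  (is "?L \<longleftrightarrow> ?R")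
proof
  assume L: ?L
  have "map snd (filter (\<lambda>e. fst e = v) es) \<in> permutations_of_set (V - {v})" if "v \<in> V" for v
  proof (rule permutations_of_setI)
    show "set (map snd (filter (\<lambda>e. fst e = v) es)) = V - {v}"
      using L that by (force simp: image_iff)
    show "distinct (map snd (filter (\<lambda>e. fst e = v) es))"
      using L by (auto simp: distinct_map inj_on_def)
  qed
  then show ?R using L by auto
next
  assume R: ?R
  have dist: "distinct (map snd (filter (\<lambda>e. fst e = v) es))" for v
  proof (cases "v \<in> V")
    case True
    then show ?thesis using R by (auto dest: permutations_of_setD)
  next
    case False
    then have "filter (\<lambda>e. fst e = v) es = []" using R by (auto simp: filter_empty_conv)
    then show ?thesis by simp
  qed
  have fibre: "snd ` {e \<in> set es. fst e = v} = V - {v}" if "v \<in> V" for v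
    using R that permutations_of_setD(1)[of "map snd (filter (\<lambda>e. fst e = v) es)" "V - {v}"] by auto
  have "(v, u) \<in> set es \<longleftrightarrow> v \<in> V \<and> u \<in> V - {v}" for v u
  proof (cases "v \<in> V")
    case True
    have "(v, u) \<in> set es \<longleftrightarrow> u \<in> snd ` {e \<in> set es. fst e = v}" by force
    then show ?thesis using fibre[OF True] True by simp
  next
    case False
    then show ?thesis using R by auto
  qed
  then show ?L using distinct_if_distinct_fibres[OF dist] by auto
qed

text \<open>Repeating the first entry at the end makes cyclic neighbours linear ones, so
  \<open>succs\<close> of the closed walk can be read off from \<open>arcs\<close>.\<close>

lemma arcs_closed_walk: "xs \<noteq> [] \<Longrightarrow> arcs xs = zip (xs @ [hd xs]) (tl (xs @ [hd xs]))"
  using zip_append1[of xs "[hd xs]" "tl xs @ [hd xs]"]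
  by (cases xs) (simp_all add: arcs_def)

lemma arcs_subset_iff: "set (arcs xs) \<subseteq> V \<times> V \<longleftrightarrow> set xs \<subseteq> V"
proof -
  have "fst ` set (arcs xs) = set xs" "snd ` set (arcs xs) = set xs"
    unfolding arcs_def set_map[symmetric] by (subst map_fst_zip map_snd_zip; simp)+
  then show ?thesis by (fastforce simp: subset_iff image_iff)
qed

lemma closed_walk_tour_iff:
  assumes "xs \<noteq> []"
  shows "xs @ [hd xs] \<in> tours V r \<longleftrightarrow>
         hd xs = r \<and> distinct (arcs xs) \<and> set (arcs xs) = (SIGMA v:V. V - {v})"
  unfolding distinct_arcs_iff arcs_subset_iff
  using assms by (auto simp: tours_def succs_def arcs_closed_walk)

text \<open>A cyclic list is written as a closed walk, and dropping the final entry goes back. The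
  window at position 0 is the first arc.\<close>

lemma universal_cycle_lists_tours_bij:
  assumes "r \<in> {1..n}" "s \<in> {1..n}" "r \<noteq> s"
  shows "bij_betw (\<lambda>xs. xs @ [hd xs])
           {xs \<in> universal_cycle_lists n 2. cyclic_window xs 2 0 = [r, s]}
           {w \<in> tours {1..n} r. hd (tl w) = s}"
    (is "bij_betw ?f ?U ?W")
proof (rule bij_betw_imageI)
  show "inj_on ?f ?U" by (auto simp: inj_on_def)
  have second: "hd (tl (xs @ [hd xs])) = snd (arcs xs ! 0)" if "xs \<noteq> []" for xs :: "nat list"
    using that by (cases xs; cases "tl xs") (auto simp: arcs_def)
  have first: "fst (arcs xs ! 0) = hd xs" if "xs \<noteq> []" for xs :: "nat list"
    using that by (cases xs; cases "tl xs") (auto simp: arcs_def)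
  show "?f ` ?U = ?W"
  proof (rule subset_antisym; rule subsetI)
    fix w assume "w \<in> ?f ` ?U"
    then obtain xs where w: "w = ?f xs" and U: "xs \<in> ?U" by (rule imageE)
    then have a: "distinct (arcs xs) \<and> set (arcs xs) = (SIGMA v:{1..n}. {1..n} - {v})"
      by (simp add: universal_cycle_lists_2)
    moreover have "(r, s) \<in> (SIGMA v:{1..n}. {1..n} - {v})" using assms by simp
    ultimately have "(r, s) \<in> set (arcs xs)" by simp
    then have ne: "xs \<noteq> []" by (auto simp: arcs_def)
    then have "hd xs = r" "snd (arcs xs ! 0) = s"
      using U first[OF ne] cyclic_window_2[of 0 xs] by simp_all
    then show "w \<in> ?W"
      using w a second[OF ne] closed_walk_tour_iff[OF ne, of "{1..n}" r] by simp
  next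
    fix w assume w: "w \<in> ?W"
    then have perm: "succs r w \<in> permutations_of_set ({1..n} - {r})"
      and ends: "w \<noteq> []" "hd w = r" "last w = r" using assms by (auto simp: tours_def)
    have "s \<in> set (succs r w)" using permutations_of_setD(1)[OF perm] assms by simp
    then have "tl w \<noteq> []" by (auto simp: succs_def)
    \<comment> \<open>Having more than one entry, the walk keeps its head \<open>r\<close> when the
      final entry is dropped.\<close>
    then obtain xs where f: "w = ?f xs" and ne: "xs \<noteq> []"
      using ends by (cases w rule: rev_cases) (auto simp: hd_append split: if_splits)
    then have arcs: "hd xs = r \<and> distinct (arcs xs) \<and>
        set (arcs xs) = (SIGMA v:{1..n}. {1..n} - {v})"
      using w closed_walk_tour_iff[OF ne, of "{1..n}" r] by simp
    moreover have "snd (arcs xs ! 0) = s" using w f second[OF ne] by simp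
    ultimately have "cyclic_window xs 2 0 = [r, s]"
      using first[OF ne] ne by (simp add: cyclic_window_2)
    then have "xs \<in> ?U" using arcs by (simp add: universal_cycle_lists_2)
    then show "w \<in> ?f ` ?U" using f by (rule rev_image_eqI)
  qed
qed

section \<open>Rotation classes of universal cycles\<close>

lemma equiv_rotation_rel: "equiv UNIV (rotation_rel :: ('a list \<times> 'a list) set)"
proof (rule equivI)
  show "refl (rotation_rel :: ('a list \<times> 'a list) set)"
    by (auto simp: refl_on_def rotation_rel_def intro: exI[of _ 0])
  show "trans (rotation_rel :: ('a list \<times> 'a list) set)"
    by (auto simp: trans_def rotation_rel_def rotate_rotate)
  show "sym (rotation_rel :: ('a list \<times> 'a list) set)"
  proof (rule symI)
    fix xs ys :: "'a list" assume "(xs, ys) \<in> rotation_rel"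
    then obtain m where ys: "ys = rotate m xs" by (auto simp: rotation_rel_def)
    show "(ys, xs) \<in> rotation_rel"
    proof (cases "xs = []")
      case False
      then have "m mod length xs \<le> length xs" by (simp add: less_imp_le)
      then have "rotate (length xs - m mod length xs) (rotate (m mod length xs) xs) = xs"
        by (simp add: rotate_rotate)
      then show ?thesis
        unfolding ys rotation_rel_def by (metis (mono_tags, lifting) case_prodI mem_Collect_eq rotate_conv_mod)
    qed (use ys in \<open>auto simp: rotation_rel_def\<close>)
  qed
qed simp

text \<open>\<open>arcs\<close> commutes with rotation, which preserves distinctness and the set of
  entries.\<close>

lemma universal_cycle_lists_rotate:
  "xs \<in> universal_cycle_lists n 2 \<Longrightarrow> rotate m xs \<in> universal_cycle_lists n 2"
  by (simp add: universal_cycle_lists_2 arcs_rotate)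

text \<open>As \<open>p\<close> starts at exactly one position of each list, each class has exactly
  one member with \<open>p\<close> at position 0.\<close>

lemma universal_cycles_rooted_bij:
  assumes p: "p \<in> k_permutations n 2"
  shows "bij_betw (\<lambda>xs. rotation_rel `` {xs})
           {xs \<in> universal_cycle_lists n 2. cyclic_window xs 2 0 = p} (universal_cycles n 2)"
    (is "bij_betw ?f ?U _")
proof (rule bij_betw_imageI)
  have uniq: "\<exists>!i. i < length xs \<and> cyclic_window xs 2 i = p" if "xs \<in> universal_cycle_lists n 2" for xs
    using that p unfolding universal_cycle_lists_def by blast
  show "inj_on ?f ?U"
  proof (rule inj_onI)
    fix xs ys assume xs: "xs \<in> ?U" and ys: "ys \<in> ?U" and eq: "?f xs = ?f ys"
    have "(xs, ys) \<in> rotation_rel" using eq_equiv_class[OF eq equiv_rotation_rel] by simp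
    then obtain m where m: "ys = rotate m xs" by (auto simp: rotation_rel_def)
    have U: "xs \<in> universal_cycle_lists n 2" using xs by simp
    have ne: "xs \<noteq> []" using uniq[OF U] by auto
    have "cyclic_window xs 2 (m mod length xs) = p"
      using cyclic_window_rotate[OF ne, of m 2 0] ys m by simp
    \<comment> \<open>Both \<open>m mod length xs\<close> and 0 are positions of \<open>p\<close> in
      \<open>xs\<close>, so they coincide.\<close>
    moreover have "m mod length xs < length xs" "0 < length xs" "cyclic_window xs 2 0 = p"
      using ne xs by auto
    ultimately have "m mod length xs = 0" using uniq[OF U] by blast
    then show "xs = ys" using m rotate_conv_mod[of m xs] by simp
  qed
  show "?f ` ?U = universal_cycles n 2"
  proof (rule subset_antisym; rule subsetI)
    fix c assume "c \<in> ?f ` ?U"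
    then show "c \<in> universal_cycles n 2" by (auto simp: universal_cycles_def intro: quotientI)
  next
    fix c assume "c \<in> universal_cycles n 2"
    then obtain xs where U: "xs \<in> universal_cycle_lists n 2" and c: "c = ?f xs"
      unfolding universal_cycles_def by (rule quotientE)
    obtain i where i: "i < length xs" "cyclic_window xs 2 i = p" using uniq[OF U] by blast
    then have "xs \<noteq> []" by auto
    then have "rotate i xs \<in> ?U"
      using i cyclic_window_rotate[of xs i 2 0] universal_cycle_lists_rotate[OF U] by simp
    moreover have "(xs, rotate i xs) \<in> rotation_rel" by (auto simp: rotation_rel_def)
    then have "c = ?f (rotate i xs)" unfolding c by (rule equiv_class_eq[OF equiv_rotation_rel])
    ultimately show "c \<in> ?f ` ?U" by (rule rev_image_eqI)
  qed
qed

theorem theorem1: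
  fixes n :: nat
  assumes "n \<ge> 3"
  shows "card (universal_cycles n 2) = n ^ (n - 2) * (fact (n - 2)) ^ n"
proof -
  \<comment> \<open>Any arc could serve to mark the starting point of the cycles.\<close>
  have "[1, 2] \<in> k_permutations n 2" using assms by (simp add: k_permutations_def)
  from bij_betw_same_card[OF universal_cycles_rooted_bij[OF this]]
  have "card (universal_cycles n 2) =
      card {xs \<in> universal_cycle_lists n 2. cyclic_window xs 2 0 = [1, 2]}" by simp
  also have "\<dots> = card {w \<in> tours {1..n} 1. hd (tl w) = 2}"
    using assms by (intro bij_betw_same_card[OF universal_cycle_lists_tours_bij]) auto
  also have "\<dots> = n ^ (n - 2) * fact (n - 2) ^ n"
    using card_tours[of "{1..n}" 1 2] assms by simp
  finally show ?thesis .
qed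

end
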